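(* Consider the Godunov-type multi-path scheme on a diverge (one incoming road, two outgoing roads, two paths), as described in the context, with cell $J$ being the last cell before the junction. Let the initial densities around the junction be admissible, namely $$\mu_{J-1}^{0,1}+\mu_{J-1}^{0,2}\leq\rho_{\max},\qquad \mu_{J}^{0,1}+\mu_{J}^{0,2}\leq\rho_{\max},\qquad \mu_{J+1}^{0,1}\leq\rho_{\max},\qquad \mu_{J+1}^{0,2}\leq\rho_{\max}.$$ If $$\frac{\Delta t}{\Delta x}\,\sup_{\rho\in(0,\rho_{\max})}|f'(\rho)|\leq 1,$$ then $$\mu_{J}^{n,1}+\mu_{J}^{n,2}\leq\rho_{\max}\qquad\text{for all } n\ge 0.$$
   Context: Flux. Let $\rho_{\max}>0$ and let $f\in C^0([0,\rho_{\max}])\cap C^1((0,\rho_{\max}))$ be strictly concave with $f(0)=f(\rho_{\max})=0$; let $\sigma:=\arg\max_{(0,\rho_{\max})}f$. The Godunov numerical flux is $$G(\rho_\ell,\rho_r):=\begin{cases}\min\{f(\rho_\ell),f(\rho_r)\} & \text{if }\rho_\ell\le\rho_r,\\ f(\rho_\ell) & \text{if }\rho_\ell>\rho_r\text{ and }\rho_\ell<\sigma,\\ f(\sigma) & \text{if }\rho_\ell>\rho_r\text{ and }\rho_\ell\ge\sigma\ge\rho_r,\\ f(\rho_r) & \text{if }\rho_\ell>\rho_r\text{ and }\rho_r>\sigma.\end{cases}$$ Network. One incoming road splits into two outgoing roads. Path $p\in\{1,2\}$ consists of the incoming road followed by the $p$-th outgoing road. The cells along path $p$ are indexed by consecutive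 integers $k$, so that the cells with $k\le J$ are common to both paths (incoming road), while the cells with $k>J$ along path $1$ and along path $2$ are distinct (they belong to the respective outgoing roads). $\Delta x>0$ and $\Delta t>0$ are the space and time steps, and $\mu_k^{n,p}$ is the approximate density at cell $k$ of path $p$ and time step $n$ of the vehicles following path $p$. Total density. For $p=1,2$, along path $p$, $$\omega_{k^p}^n=\begin{cases}\mu_k^{n,1}+\mu_k^{n,2} & k\le J,\\ \mu_k^{n,p} & k>J,\end{cases}$$ where $k^p$ denotes the $k$-th cell along path $p$. Scheme. At every internal cell $k$ of path $p$ (the cells $J-1,J,J+1$ being internal), for $p=1,2$ and $n\ge0$, $$\mu_{k}^{n+1,p}=\mu_{k}^{n,p}-\frac{\Delta t}{\Delta x}\left(\frac{\mu_{k}^{n,p}}{\omega_{k^p}^n}G(\omega_{k^p}^n,\omega_{(k+1)^p}^n)-\frac{\mu_{k-1}^{n,p}}{\omega_{(k-1)^p}^n}G(\omega_{(k-1)^p}^n,\omega_{k^p}^n)\right),$$ with the convention that the ratio $\mu/\omega$ is $0$ when $\omega=0$. At the first and last cell of each path, boundary values are prescribed at every time step. Standing assumption. All initial data and boundary values are nonnegative and admissible, i.e. at each cell all densities $\mu^p$ are $\ge0$ and the total density $\omega$ is $\le\rho_{\max}$. *)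

theory Defs
  imports "HOL-Analysis.Analysis"
begin

definition strictly_concave_on :: "real set \<Rightarrow> (real \<Rightarrow> real) \<Rightarrow> bool" where
  "strictly_concave_on S f \<longleftrightarrow> convex S \<and>
     (\<forall>x\<in>S. \<forall>y\<in>S. \<forall>t. x \<noteq> y \<longrightarrow> 0 < t \<longrightarrow> t < 1 \<longrightarrow>
        (1 - t) * f x + t * f y < f ((1 - t) * x + t * y))"

text \<open>Only the values of \<open>f\<close> on \<open>{0..\<rho>max}\<close> are constrained; outside it \<open>f\<close> is arbitrary.\<close>

definition admissible_flux :: "real \<Rightarrow> (real \<Rightarrow> real) \<Rightarrow> bool" where
  "admissible_flux \<rho>max f \<longleftrightarrow>
     continuous_on {0..\<rho>max} f \<and> f C1_differentiable_on {0<..<\<rho>max} \<and>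
     strictly_concave_on {0..\<rho>max} f \<and> f 0 = 0 \<and> f \<rho>max = 0"

definition critical_density :: "real \<Rightarrow> (real \<Rightarrow> real) \<Rightarrow> real" where
  "critical_density \<rho>max f = arg_max_on f {0<..<\<rho>max}"

text \<open>The last branch is reached exactly when \<open>\<rho>l > \<rho>r > \<sigma>\<close>.\<close>

definition godunov :: "real \<Rightarrow> (real \<Rightarrow> real) \<Rightarrow> real \<Rightarrow> real \<Rightarrow> real" where
  "godunov \<rho>max f \<rho>l \<rho>r =
     (let \<sigma> = critical_density \<rho>max f in
      if \<rho>l \<le> \<rho>r then min (f \<rho>l) (f \<rho>r)
      else if \<rho>l < \<sigma> then f \<rho>l
      else if \<rho>r \<le> \<sigma> then f \<sigma>
      else f \<rho>r)"

text \<open>Densities are functions \<open>\<mu> n p k\<close> of the time step \<open>n\<close>, the path \<open>p \<in> {1, 2}\<close> and the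
  cell index \<open>k\<close> along path \<open>p\<close>.\<close>

definition total_density ::
  "int \<Rightarrow> (nat \<Rightarrow> nat \<Rightarrow> int \<Rightarrow> real) \<Rightarrow> nat \<Rightarrow> nat \<Rightarrow> int \<Rightarrow> real" where
  "total_density J \<mu> n p k = (if k \<le> J then \<mu> n 1 k + \<mu> n 2 k else \<mu> n p k)"

text \<open>Flux of the vehicles following path \<open>p\<close> from cell \<open>k\<close> to cell \<open>k + 1\<close>. The ratio
  \<open>\<mu> / \<omega>\<close> is \<open>0\<close> for \<open>\<omega> = 0\<close>, as division by zero yields zero in HOL.\<close>

definition path_flux ::
  "real \<Rightarrow> (real \<Rightarrow> real) \<Rightarrow> int \<Rightarrow> (nat \<Rightarrow> nat \<Rightarrow> int \<Rightarrow> real) \<Rightarrow> nat \<Rightarrow> nat \<Rightarrow> int \<Rightarrow> real" where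
  "path_flux \<rho>max f J \<mu> n p k =
     \<mu> n p k / total_density J \<mu> n p k *
     godunov \<rho>max f (total_density J \<mu> n p k) (total_density J \<mu> n p (k + 1))"

text \<open>\<open>a\<close> is the first cell of both paths (they share the incoming road) and \<open>b p\<close> the last cell
  of path \<open>p\<close>. The values at these cells are prescribed, hence not subject to the scheme.\<close>

definition multipath_scheme ::
  "real \<Rightarrow> (real \<Rightarrow> real) \<Rightarrow> real \<Rightarrow> real \<Rightarrow> int \<Rightarrow> int \<Rightarrow> (nat \<Rightarrow> int) \<Rightarrow>
   (nat \<Rightarrow> nat \<Rightarrow> int \<Rightarrow> real) \<Rightarrow> bool" where
  "multipath_scheme \<rho>max f \<Delta>x \<Delta>t J a b \<mu> \<longleftrightarrow>
     (\<forall>n. \<forall>p\<in>{1, 2}. \<forall>k\<in>{a<..<b p}.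
        \<mu> (Suc n) p k =
          \<mu> n p k - \<Delta>t / \<Delta>x * (path_flux \<rho>max f J \<mu> n p k - path_flux \<rho>max f J \<mu> n p (k - 1)))"

definition admissible_at ::
  "real \<Rightarrow> int \<Rightarrow> (nat \<Rightarrow> nat \<Rightarrow> int \<Rightarrow> real) \<Rightarrow> nat \<Rightarrow> nat \<Rightarrow> int \<Rightarrow> bool" where
  "admissible_at \<rho>max J \<mu> n p k \<longleftrightarrow> 0 \<le> \<mu> n p k \<and> total_density J \<mu> n p k \<le> \<rho>max"

end

theory Submission
  imports Defs
begin

text \<open>Since \<open>f\<close> vanishes at both end points, the CFL condition and the mean value theorem give
  \<open>\<lambda> f x \<le> min x (\<rho>max - x)\<close> for \<open>\<lambda> = \<Delta>t / \<Delta>x\<close>. For \<open>\<rho>l \<le> \<rho>r\<close> the Godunov flux is bounded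
  by both \<open>f \<rho>l\<close> and \<open>f \<rho>r\<close>, otherwise it is a value of \<open>f\<close> at some point of
  \<open>[\<rho>r, \<rho>l]\<close>; in all cases \<open>0 \<le> \<lambda> G \<rho>l \<rho>r \<le> min \<rho>l (\<rho>max - \<rho>r)\<close>. Hence a cell never
  loses more than its content nor receives more than its free space. Admissibility of all cells
  is therefore preserved by a time step; at the junction only the inflow matters for the upper
  bound, because the two outgoing fluxes are nonnegative.\<close>

text \<open>A concave function lies above its chord, and the chord of \<open>f\<close> from
  \<open>0\<close> to \<open>\<rho>max\<close> is zero.\<close>

lemma admissible_flux_nonneg:
  assumes "admissible_flux \<rho>max f" and "x \<in> {0..\<rho>max}"
  shows "0 \<le> f x"
proof (cases "x = 0 \<or> x = \<rho>max")
  case True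
  then show ?thesis using assms by (auto simp: admissible_flux_def)
next
  case False
  have "0 < x / \<rho>max" "x / \<rho>max < 1" "0 < \<rho>max" "(x / \<rho>max) * \<rho>max = x"
    using False assms(2) by auto
  moreover have "strictly_concave_on {0..\<rho>max} f" "f 0 = 0" "f \<rho>max = 0"
    using assms(1) by (auto simp: admissible_flux_def)
  moreover have "0 \<in> {0..\<rho>max}" "\<rho>max \<in> {0..\<rho>max}" using assms(2) by auto
  ultimately have "(1 - x / \<rho>max) * f 0 + x / \<rho>max * f \<rho>max
      < f ((1 - x / \<rho>max) * 0 + x / \<rho>max * \<rho>max)"
    unfolding strictly_concave_on_def by (metis less_irrefl)
  then show ?thesis using \<open>f 0 = 0\<close> \<open>f \<rho>max = 0\<close> \<open>0 < \<rho>max\<close> by simp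
qed

text \<open>The mean value theorem asks for differentiability only between \<open>x\<close> and
  \<open>y\<close>, so the end points \<open>0\<close> and \<open>\<rho>max\<close> are allowed;
  there \<open>f\<close> vanishes and the estimate turns into a bound on \<open>f\<close>
  itself.\<close>

lemma cfl_lipschitz:
  assumes flux: "admissible_flux \<rho>max f" and "0 \<le> c"
    and CFL: "ereal c * (SUP \<rho>\<in>{0<..<\<rho>max}. ereal \<bar>deriv f \<rho>\<bar>) \<le> 1"
    and "0 \<le> x" "x < y" "y \<le> \<rho>max"
  shows "c * \<bar>f y - f x\<bar> \<le> y - x"
proof -
  have cont: "continuous_on {x..y} f"
    using flux assms(4-6) unfolding admissible_flux_def
    by (auto intro: continuous_on_subset)
  have diff: "(f has_real_derivative deriv f z) (at z)" if "z \<in> {0<..<\<rho>max}" for z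
    using flux that
    by (auto simp: admissible_flux_def C1_differentiable_on_eq DERIV_deriv_iff_real_differentiable)
  obtain l z where z: "x < z" "z < y" and l: "(f has_real_derivative l) (at z)"
    "f y - f x = (y - x) * l"
    using MVT[OF \<open>x < y\<close> cont] diff assms(4-6) real_differentiable_def
    by (metis greaterThanLessThan_iff le_less_trans less_le_trans)
  have mv: "f y - f x = (y - x) * deriv f z" using l by (simp add: DERIV_imp_deriv)
  have "ereal \<bar>deriv f z\<bar> \<le> (SUP \<rho>\<in>{0<..<\<rho>max}. ereal \<bar>deriv f \<rho>\<bar>)"
    using z assms(4-6) by (intro SUP_upper) auto
  then have "ereal c * ereal \<bar>deriv f z\<bar> \<le> 1"
    using CFL \<open>0 \<le> c\<close> by (meson ereal_less_eq(5) ereal_mult_left_mono order_trans)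
  then have "c * \<bar>deriv f z\<bar> \<le> 1" by (simp add: one_ereal_def)
  then have "(y - x) * (c * \<bar>deriv f z\<bar>) \<le> (y - x) * 1"
    using \<open>x < y\<close> by (intro mult_left_mono) auto
  then show ?thesis using mv \<open>x < y\<close> by (simp add: abs_mult ac_simps)
qed

lemma cfl_flux_bounds:
  assumes "admissible_flux \<rho>max f" "0 \<le> c"
    and "ereal c * (SUP \<rho>\<in>{0<..<\<rho>max}. ereal \<bar>deriv f \<rho>\<bar>) \<le> 1"
    and "x \<in> {0..\<rho>max}"
  shows "c * f x \<le> x" "c * f x \<le> \<rho>max - x"
proof -
  have ends: "f 0 = 0" "f \<rho>max = 0" using assms(1) by (auto simp: admissible_flux_def)
  have nonneg: "0 \<le> f x" using admissible_flux_nonneg assms by blast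
  show "c * f x \<le> x"
    using cfl_lipschitz[OF assms(1-3), of 0 x] assms(4) ends nonneg by (cases "x = 0") auto
  show "c * f x \<le> \<rho>max - x"
    using cfl_lipschitz[OF assms(1-3), of x \<rho>max] assms(4) ends nonneg by (cases "x = \<rho>max") auto
qed

lemma godunov_bounds:
  assumes f: "\<forall>x\<in>{0..\<rho>max}. 0 \<le> f x \<and> c * f x \<le> x \<and> c * f x \<le> \<rho>max - x"
    and "0 \<le> c" and l: "l \<in> {0..\<rho>max}" and r: "r \<in> {0..\<rho>max}"
  shows "0 \<le> godunov \<rho>max f l r" "c * godunov \<rho>max f l r \<le> l"
    "c * godunov \<rho>max f l r \<le> \<rho>max - r"
proof -
  define G where "G = godunov \<rho>max f l r"
  have "0 \<le> G \<and> c * G \<le> l \<and> c * G \<le> \<rho>max - r"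
  proof (cases "l \<le> r")
    case True
    then have "G = min (f l) (f r)" by (simp add: G_def godunov_def)
    moreover have "c * min (f l) (f r) \<le> c * f l" "c * min (f l) (f r) \<le> c * f r"
      using \<open>0 \<le> c\<close> by (auto intro: mult_left_mono)
    ultimately show ?thesis using f l r by fastforce
  next
    case False
    \<comment> \<open>The remaining branches evaluate \<open>f\<close> at \<open>l\<close>, at the
      critical density (which then lies between \<open>r\<close> and \<open>l\<close>) or at
      \<open>r\<close>; \<open>s\<close> is that point. Its bounds pass to \<open>l\<close> and
      \<open>r\<close> by monotonicity.\<close>
    then obtain s where "r \<le> s" "s \<le> l" "G = f s"
      unfolding G_def godunov_def Let_def by (smt (verit))
    then show ?thesis using f[rule_format, of s] l r by auto
  qed
  then show "0 \<le> godunov \<rho>max f l r" "c * godunov \<rho>max f l r \<le> l"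
    "c * godunov \<rho>max f l r \<le> \<rho>max - r" by (auto simp: G_def)
qed

text \<open>For \<open>w = 0\<close> the quotient is \<open>0\<close>, which is harmless because then \<open>m = 0\<close>.\<close>

lemma fraction_flux_bounds:
  fixes m w g :: real
  assumes "0 \<le> m" "m \<le> w" "0 \<le> c" "0 \<le> g"
  shows "0 \<le> m / w * g" "c * (m / w * g) \<le> c * g" "c * g \<le> w \<Longrightarrow> c * (m / w * g) \<le> m"
proof -
  have frac: "0 \<le> m / w" "m / w \<le> 1" using assms by (auto simp: divide_le_eq_1)
  show "0 \<le> m / w * g" using frac assms by simp
  show "c * (m / w * g) \<le> c * g"
    using frac assms by (intro mult_left_mono mult_left_le_one_le) auto
  show "c * (m / w * g) \<le> m" if "c * g \<le> w"
  proof (cases "w = 0")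
    case False
    have "m / w * (c * g) \<le> m / w * w" using frac that by (intro mult_left_mono)
    then show ?thesis using False by (simp add: ac_simps)
  qed (use assms in auto)
qed

text \<open>Both paths are assumed admissible at once, because the total density on the incoming
  road couples them.\<close>

lemma admissible_step:
  assumes f: "\<forall>x\<in>{0..\<rho>max}. 0 \<le> f x \<and> c * f x \<le> x \<and> c * f x \<le> \<rho>max - x"
    and c: "0 \<le> c" "c = \<Delta>t / \<Delta>x"
    and J: "\<forall>p\<in>{1, 2}. J < b p"
    and scheme: "multipath_scheme \<rho>max f \<Delta>x \<Delta>t J a b \<mu>"
    and adm: "\<forall>p\<in>{1, 2}. \<forall>k\<in>{a..b p}. admissible_at \<rho>max J \<mu> n p k"
    and p: "p \<in> {1, 2}" and k: "k \<in> {a<..<b p}"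
  shows "admissible_at \<rho>max J \<mu> (Suc n) p k"
proof -
  let ?w = "total_density J \<mu> n" and ?F = "path_flux \<rho>max f J \<mu> n"
  let ?G = "\<lambda>q i. godunov \<rho>max f (?w q i) (?w q (i + 1))"
  have nonneg: "0 \<le> \<mu> n q i" if "q \<in> {1, 2}" "i \<in> {a..b q}" for q i
    using adm that by (auto simp: admissible_at_def)
  \<comment> \<open>For \<open>i \<le> J\<close> the other path contributes a nonnegative density:
    by \<open>J < b p\<close> the cell \<open>i\<close> belongs to both paths.\<close>
  have part: "\<mu> n q i \<le> ?w q i" if "q \<in> {1, 2}" "i \<in> {a..b q}" for q i
    using that nonneg[of 1 i] nonneg[of 2 i] J by (auto simp: total_density_def)
  have w: "?w q i \<in> {0..\<rho>max}" if "q \<in> {1, 2}" "i \<in> {a..b q}" for q i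
    using adm nonneg[OF that] part[OF that] that by (fastforce simp: admissible_at_def)
  have G: "0 \<le> ?G q i" "c * ?G q i \<le> ?w q i" "c * ?G q i \<le> \<rho>max - ?w q (i + 1)"
    if "q \<in> {1, 2}" "i \<in> {a..<b q}" for q i
    using godunov_bounds[OF f c(1) w w, of q i q "i + 1"] that by auto
  have F: "0 \<le> ?F q i" "c * ?F q i \<le> \<mu> n q i" "c * ?F q i \<le> c * ?G q i"
    if "q \<in> {1, 2}" "i \<in> {a..<b q}" for q i
    using fraction_flux_bounds[OF nonneg part c(1) G(1), of q i q i] G(2)[OF that] that
    by (auto simp: path_flux_def)
  have upd: "\<mu> (Suc n) q i = \<mu> n q i - (c * ?F q i - c * ?F q (i - 1))"
    if "q \<in> {1, 2}" "i \<in> {a<..<b q}" for q i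
    using scheme that unfolding multipath_scheme_def c(2)[symmetric] right_diff_distrib[symmetric] by blast
  have cF: "0 \<le> c * ?F q i" if "q \<in> {1, 2}" "i \<in> {a..<b q}" for q i
    using F(1)[OF that] c(1) by simp
  \<comment> \<open>The outflow is at most the content of the cell, and the inflow is
    nonnegative.\<close>
  have pos: "0 \<le> \<mu> (Suc n) p k"
    using upd[OF p k] F(2)[OF p, of k] cF[OF p, of "k - 1"] k by auto
  have "total_density J \<mu> (Suc n) p k \<le> \<rho>max"
  proof (cases "k \<le> J")
    case True
    let ?l = "?w 1 (k - 1)"
    have range: "k \<in> {a<..<b 1}" "k \<in> {a<..<b 2}" using True k p J by auto
    \<comment> \<open>Since \<open>k \<le> J\<close>, the interface between \<open>k - 1\<close> and
      \<open>k\<close> carries the same Godunov flux for both paths, so the two shares of the inflow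
      add up to that single flux, even for \<open>k = J\<close>.\<close>
    have same: "?w 2 (k - 1) = ?l" "?w 2 k = ?w 1 k" using True by (auto simp: total_density_def)
    have "?F 1 (k - 1) + ?F 2 (k - 1) = (\<mu> n 1 (k - 1) + \<mu> n 2 (k - 1)) / ?l * ?G 1 (k - 1)"
      by (simp add: path_flux_def same add_divide_distrib distrib_right)
    also have "\<mu> n 1 (k - 1) + \<mu> n 2 (k - 1) = ?l" using True by (simp add: total_density_def)
    finally have sum: "?F 1 (k - 1) + ?F 2 (k - 1) = ?l / ?l * ?G 1 (k - 1)" .
    \<comment> \<open>Only an inequality, because \<open>?l / ?l\<close> is \<open>0\<close> for an
      empty cell and \<open>1\<close> otherwise.\<close>
    have "c * (?l / ?l * ?G 1 (k - 1)) \<le> c * ?G 1 (k - 1)"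
      using w[of 1 "k - 1"] G(1)[of 1 "k - 1"] c(1) range
      by (intro fraction_flux_bounds) auto
    also have "\<dots> \<le> \<rho>max - ?w 1 k" using G(3)[of 1 "k - 1"] range by simp
    finally have "c * ?F 1 (k - 1) + c * ?F 2 (k - 1) \<le> \<rho>max - ?w 1 k"
      unfolding sum[symmetric] distrib_left .
    moreover have "?w 1 k = \<mu> n 1 k + \<mu> n 2 k" using True by (simp add: total_density_def)
    ultimately show ?thesis
      using True upd[of 1 k] upd[of 2 k] cF[of 1 k] cF[of 2 k] range
      by (auto simp: total_density_def)
  next
    case False
    \<comment> \<open>Beyond the junction a single path fills the cell. For \<open>k = J + 1\<close>
      its inflow is just a share of the Godunov flux leaving cell \<open>J\<close>, hence at most
      that flux.\<close>
    have "c * ?F p (k - 1) \<le> \<rho>max - ?w p k"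
      using F(3)[OF p, of "k - 1"] G(3)[OF p, of "k - 1"] k by auto
    then show ?thesis
      using False upd[OF p k] cF[OF p, of k] k by (auto simp: total_density_def)
  qed
  with pos show ?thesis by (simp add: admissible_at_def)
qed

theorem theorem3p2:
  fixes \<rho>max \<Delta>x \<Delta>t :: real and f :: "real \<Rightarrow> real"
    and J a :: int and b :: "nat \<Rightarrow> int"
    and \<mu> :: "nat \<Rightarrow> nat \<Rightarrow> int \<Rightarrow> real"
  assumes "\<rho>max > 0" and "admissible_flux \<rho>max f"
    and "\<Delta>x > 0" and "\<Delta>t > 0"
    and junction_internal: "\<forall>p\<in>{1, 2}. {J - 1, J, J + 1} \<subseteq> {a<..<b p}"
    and scheme: "multipath_scheme \<rho>max f \<Delta>x \<Delta>t J a b \<mu>"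
    and initial: "\<forall>p\<in>{1, 2}. \<forall>k\<in>{a..b p}. admissible_at \<rho>max J \<mu> 0 p k"
    and boundary: "\<forall>n. \<forall>p\<in>{1, 2}. \<forall>k\<in>{a, b p}. admissible_at \<rho>max J \<mu> n p k"
    and "\<mu> 0 1 (J - 1) + \<mu> 0 2 (J - 1) \<le> \<rho>max"
    and "\<mu> 0 1 J + \<mu> 0 2 J \<le> \<rho>max"
    and "\<mu> 0 1 (J + 1) \<le> \<rho>max"
    and "\<mu> 0 2 (J + 1) \<le> \<rho>max"
    and CFL: "ereal (\<Delta>t / \<Delta>x) * (SUP \<rho>\<in>{0<..<\<rho>max}. ereal \<bar>deriv f \<rho>\<bar>) \<le> 1"
  shows "\<forall>n. \<mu> n 1 J + \<mu> n 2 J \<le> \<rho>max"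
proof -
  define c where "c = \<Delta>t / \<Delta>x"
  have c: "0 \<le> c" using \<open>\<Delta>x > 0\<close> \<open>\<Delta>t > 0\<close> by (simp add: c_def)
  have f: "\<forall>x\<in>{0..\<rho>max}. 0 \<le> f x \<and> c * f x \<le> x \<and> c * f x \<le> \<rho>max - x"
    using admissible_flux_nonneg[OF \<open>admissible_flux \<rho>max f\<close>]
      cfl_flux_bounds[OF \<open>admissible_flux \<rho>max f\<close> c CFL[folded c_def]] by blast
  have J: "\<forall>p\<in>{1, 2}. J < b p" using junction_internal by auto
  \<comment> \<open>The claim about cell \<open>J\<close> is strengthened to all cells, since each
    update draws on the neighbouring cells.\<close>
  have adm: "\<forall>p\<in>{1, 2}. \<forall>k\<in>{a..b p}. admissible_at \<rho>max J \<mu> n p k" for n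
  proof (induction n)
    case 0
    show ?case by (fact initial)
  next
    case (Suc n)
    show ?case
    proof (intro ballI)
      fix p k assume p: "p \<in> {1, 2 :: nat}" and k: "k \<in> {a..b p}"
      show "admissible_at \<rho>max J \<mu> (Suc n) p k"
      proof (cases "k \<in> {a, b p}")
        case True
        then show ?thesis using boundary p by blast
      next
        case False
        then have "k \<in> {a<..<b p}" using k by auto
        then show ?thesis by (rule admissible_step[OF f c c_def J scheme Suc.IH p])
      qed
    qed
  qed
  show ?thesis
  proof
    fix n
    have "J \<in> {a..b 1}" using junction_internal by auto
    then have "admissible_at \<rho>max J \<mu> n 1 J" using adm by blast
    then show "\<mu> n 1 J + \<mu> n 2 J \<le> \<rho>max"
      by (simp add: admissible_at_def total_density_def)
  qed
qed

end
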